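(* Let $w_{1},w_{2},w_{3}$ be any odd positive integers and $n\ge0$ an integer. Then for all $y_1$: \begin{align*} &(w_{1}w_{2})^{n}\sum_{i=0}^{w_{1}-1}\sum_{j=0}^{w_{2}-1}(-1)^{i+j}E_{n}\Big(w_{3}y_{1}+\frac{w_{3}}{w_{1}}i+\frac{w_{3}}{w_{2}}j\Big)\\ =&(w_{2}w_{3})^{n}\sum_{i=0}^{w_{2}-1}\sum_{j=0}^{w_{3}-1}(-1)^{i+j}E_{n}\Big(w_{1}y_{1}+\frac{w_{1}}{w_{2}}i+\frac{w_{1}}{w_{3}}j\Big)\\ =&(w_{3}w_{1})^{n}\sum_{i=0}^{w_{3}-1}\sum_{j=0}^{w_{1}-1}(-1)^{i+j}E_{n}\Big(w_{2}y_{1}+\frac{w_{2}}{w_{3}}i+\frac{w_{2}}{w_{1}}j\Big). \end{align*}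
   Context: The Euler polynomials $E_n(x)$ are defined by $\frac{2}{e^{t}+1}e^{xt}=\sum_{n=0}^{\infty}E_{n}(x)\frac{t^{n}}{n!}$. *)

theory Defs
  imports "HOL-Computational_Algebra.Computational_Algebra"
begin

text \<open>
  The generating function is read as a formal power series in \<open>t\<close>; the constant term of the
  denominator \<open>e\<^sup>t + 1\<close> is \<open>2 \<noteq> 0\<close>, so the division is by a unit. Values are taken in an
  arbitrary field of characteristic 0.
\<close>

definition euler_gf :: "'a::field_char_0 \<Rightarrow> 'a fps" where
  "euler_gf x = 2 / (fps_exp 1 + 1) * fps_exp x"

definition euler_poly :: "nat \<Rightarrow> 'a::field_char_0 \<Rightarrow> 'a" where
  "euler_poly n x = fps_nth (euler_gf x) n * fact n"

lemma euler_gf_eq: "euler_gf x = Abs_fps (\<lambda>n. euler_poly n x / fact n)"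
  by (simp add: euler_poly_def fps_eq_iff)

lemma euler_gf_mult: "(fps_exp 1 + 1) * euler_gf x = 2 * fps_exp (x::'a::field_char_0)"
proof -
  have "fps_nth (fps_exp 1 + 1 :: 'a fps) 0 \<noteq> 0"
    by simp
  then have "(fps_exp 1 + 1 :: 'a fps) * (2 / (fps_exp 1 + 1)) = 2"
    by (simp add: fps_divide_unit inverse_mult_eq_1' mult.left_commute)
  then show ?thesis
    unfolding euler_gf_def by (simp flip: mult.assoc)
qed

lemma euler_poly_is_poly:
  "\<exists>p :: 'a::field_char_0 poly. \<forall>x. euler_poly n x = poly p x"
proof -
  define c where "c = fps_nth (2 / (fps_exp 1 + 1) :: 'a fps)"
  have "euler_poly n x = poly (\<Sum>i=0..n. monom (fact n * c i / fact (n - i)) (n - i)) x" for x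
    unfolding euler_poly_def euler_gf_def fps_mult_nth c_def
    by (simp add: poly_sum poly_monom sum_distrib_left sum_distrib_right mult_ac)
  then show ?thesis by blast
qed

end

theory Submission
  imports Defs
begin

text \<open>
  With \<open>a, b, c\<close> odd and \<open>E(k) = e\<^sup>k\<^sup>t + 1\<close>, the exponential generating function in \<open>n\<close> of the double
  sum for \<open>(a, b, c)\<close> satisfies
  \<open>E(ab) E(bc) E(ca) D = 2 e\<^sup>a\<^sup>b\<^sup>c\<^sup>y\<^sup>t (E(abc))\<^sup>2\<close>: multiplication by \<open>E(ab)\<close> turns the Euler generating
  functions into exponentials, and the two remaining alternating geometric sums are summed by
  \<open>E(bc)\<close> and \<open>E(ca)\<close>. Both the cofactor and the right-hand side are symmetric in \<open>a, b, c\<close>,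
  so \<open>D\<close> is symmetric too.
\<close>

text \<open>Composing with \<open>fps_const (of_nat (a * b)) * fps_X\<close> rescales t to abt,
  which puts the prefactor (ab)^n into the n-th coefficient.\<close>

definition euler_double_sum_gf :: "nat \<Rightarrow> nat \<Rightarrow> nat \<Rightarrow> 'a::field_char_0 \<Rightarrow> 'a fps" where
  "euler_double_sum_gf a b c y = (\<Sum>i=0..<a. \<Sum>j=0..<b. (-1) ^ (i + j) *
     (euler_gf (of_nat c * y + of_nat c / of_nat a * of_nat i + of_nat c / of_nat b * of_nat j)
        oo (fps_const (of_nat (a * b)) * fps_X)))"

lemma fps_nth_minus_one_power_mult:
  "fps_nth ((-1) ^ k * f) n = (-1) ^ k * fps_nth (f :: 'a::comm_ring_1 fps) n"
  by (cases "even k") auto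

lemma euler_double_sum_gf_nth:
  "fps_nth (euler_double_sum_gf a b c y) n * fact n =
     of_nat (a * b) ^ n * (\<Sum>i=0..<a. \<Sum>j=0..<b. (-1) ^ (i + j) *
       euler_poly n (of_nat c * y + of_nat c / of_nat a * of_nat i + of_nat c / of_nat b * of_nat j))"
  unfolding euler_double_sum_gf_def fps_compose_linear euler_poly_def
  by (simp add: fps_sum_nth fps_nth_minus_one_power_mult sum_distrib_left sum_distrib_right mult_ac)

text \<open>Substituting kt for t is a ring homomorphism, so it carries over the defining equation
  of \<open>euler_gf\<close>.\<close>

lemma euler_gf_compose_mult:
  fixes x k :: "'a::field_char_0"
  shows "(fps_exp k + 1) * (euler_gf x oo (fps_const k * fps_X)) = 2 * fps_exp (k * x)"
proof -
  have "((fps_exp 1 + 1) * euler_gf x) oo (fps_const k * fps_X)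
      = (2 * fps_exp x) oo (fps_const k * fps_X)"
    by (simp only: euler_gf_mult)
  moreover have "(2 :: 'a fps) oo (fps_const k * fps_X) = 2"
    by (metis fps_const_compose numeral_fps_const)
  ultimately show ?thesis
    by (simp add: fps_compose_mult_distrib fps_compose_add_distrib fps_exp_compose_linear)
qed

text \<open>The product telescopes to \<open>1 - (-1) ^ k * q ^ k\<close> for every
  \<open>k\<close>; an odd exponent makes the last sign positive.\<close>

lemma alternating_geometric_sum_odd:
  fixes q :: "'a::comm_ring_1"
  assumes "odd m"
  shows "(q + 1) * (\<Sum>i=0..<m. (-1) ^ i * q ^ i) = q ^ m + 1"
proof -
  have "(q + 1) * (\<Sum>i=0..<k. (-1) ^ i * q ^ i) = 1 - (-1) ^ k * q ^ k" for k
    by (induction k) (simp_all add: algebra_simps)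
  with assms show ?thesis by simp
qed

lemma fps_exp_power_of_nat: "fps_exp (of_nat k * x) = fps_exp (x :: 'a::field_char_0) ^ k"
  by (simp add: fps_exp_power_mult)

lemma euler_double_sum_gf_mult:
  fixes y :: "'a::field_char_0"
  assumes "odd a" "odd b"
  shows "(fps_exp (of_nat (a * b)) + 1) * (fps_exp (of_nat (b * c)) + 1)
           * (fps_exp (of_nat (c * a)) + 1) * euler_double_sum_gf a b c y
       = 2 * fps_exp (of_nat (a * b * c) * y) * (fps_exp (of_nat (a * b * c)) + 1)\<^sup>2"
proof -
  let ?e = "\<lambda>k. fps_exp (of_nat k) :: 'a fps"
  let ?z = "fps_exp (of_nat (a * b * c) * y) :: 'a fps"
  have nz: "of_nat a \<noteq> (0::'a)" "of_nat b \<noteq> (0::'a)"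
    using assms by (auto simp: odd_pos)
  \<comment> \<open>The scale ab clears both denominators and splits the exponent into a constant,
    an \<open>i\<close> part and a \<open>j\<close> part, so the summand will factor.\<close>
  have arg: "of_nat (a * b) * (of_nat c * y + of_nat c / of_nat a * of_nat i
                + of_nat c / of_nat b * of_nat j)
           = of_nat (a * b * c) * y + of_nat i * of_nat (b * c) + of_nat j * (of_nat (c * a) :: 'a)"
    for i j
    using nz by (simp add: field_simps)
  have "(?e (a * b) + 1) * euler_double_sum_gf a b c y
      = (\<Sum>i=0..<a. \<Sum>j=0..<b. (-1) ^ (i + j) * (2 * fps_exp (of_nat (a * b) *
          (of_nat c * y + of_nat c / of_nat a * of_nat i + of_nat c / of_nat b * of_nat j))))"
    unfolding euler_double_sum_gf_def sum_distrib_left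
    by (simp only: mult.left_commute[of "?e (a * b) + 1"] euler_gf_compose_mult)
  also have "\<dots> = (\<Sum>i=0..<a. \<Sum>j=0..<b. 2 * ?z *
      (((-1) ^ i * ?e (b * c) ^ i) * ((-1) ^ j * ?e (c * a) ^ j)))"
    \<comment> \<open>Instantiating with \<open>of_nat _\<close> turns only the \<open>i\<close> and
      \<open>j\<close> exponentials into powers and leaves \<open>?z\<close> intact.\<close>
    unfolding arg fps_exp_add_mult fps_exp_power_of_nat[of _ "of_nat _"] power_add
    by (simp only: mult_ac)
  also have "\<dots> = 2 * ?z * ((\<Sum>i=0..<a. (-1) ^ i * ?e (b * c) ^ i)
                        * (\<Sum>j=0..<b. (-1) ^ j * ?e (c * a) ^ j))"
    unfolding sum_product by (simp only: sum_distrib_left)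
  finally have *: "(?e (a * b) + 1) * euler_double_sum_gf a b c y = \<dots>" .
  have "(?e (a * b) + 1) * (?e (b * c) + 1) * (?e (c * a) + 1) * euler_double_sum_gf a b c y
      = (?e (b * c) + 1) * (?e (c * a) + 1) * ((?e (a * b) + 1) * euler_double_sum_gf a b c y)"
    by (simp only: mult_ac)
  also have "\<dots> = 2 * ?z * (((?e (b * c) + 1) * (\<Sum>i=0..<a. (-1) ^ i * ?e (b * c) ^ i))
               * ((?e (c * a) + 1) * (\<Sum>j=0..<b. (-1) ^ j * ?e (c * a) ^ j)))"
    unfolding * by (simp only: mult_ac)
  also have "\<dots> = 2 * ?z * ((?e (b * c) ^ a + 1) * (?e (c * a) ^ b + 1))"
    by (simp only: alternating_geometric_sum_odd[OF assms(1)] alternating_geometric_sum_odd[OF assms(2)])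
  \<comment> \<open>Both geometric sums end at the same exponential, whence the square.\<close>
  also have "?e (b * c) ^ a = ?e (a * b * c)"
    by (simp add: fps_exp_power_mult mult_ac)
  also have "?e (c * a) ^ b = ?e (a * b * c)"
    by (simp add: fps_exp_power_mult mult_ac)
  finally show ?thesis by (simp only: power2_eq_square)
qed

lemma euler_double_sum_gf_rotate:
  fixes y :: "'a::field_char_0"
  assumes "odd a" "odd b" "odd c"
  shows "euler_double_sum_gf a b c y = euler_double_sum_gf b c a y"
proof -
  let ?P = "(fps_exp (of_nat (a * b)) + 1) * (fps_exp (of_nat (b * c)) + 1)
              * (fps_exp (of_nat (c * a)) + 1) :: 'a fps"
  \<comment> \<open>The constant term is 2, nonzero in characteristic 0.\<close>
  have nz: "fps_exp x + 1 \<noteq> 0" for x :: 'a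
  proof
    assume "fps_exp x + 1 = 0"
    then have "fps_nth (fps_exp x + 1) 0 = 0" by simp
    then show False by simp
  qed
  \<comment> \<open>A cyclic shift only permutes the factors of \<open>?P\<close> and of the product
    abc.\<close>
  have "?P * euler_double_sum_gf a b c y = ?P * euler_double_sum_gf b c a y"
    using euler_double_sum_gf_mult[OF assms(1,2), of c y]
      euler_double_sum_gf_mult[OF assms(2,3), of a y]
    by (simp only: mult_ac)
  then show ?thesis by (simp only: mult_left_cancel nz mult_eq_0_iff simp_thms)
qed

theorem theorem14:
  fixes w1 w2 w3 n :: nat and y1 :: "'a::field_char_0"
  assumes "odd w1" and "odd w2" and "odd w3"
  shows
    "of_nat (w1 * w2) ^ n * (\<Sum>i=0..<w1. \<Sum>j=0..<w2. (-1) ^ (i + j) *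
        euler_poly n (of_nat w3 * y1 + of_nat w3 / of_nat w1 * of_nat i
                                     + of_nat w3 / of_nat w2 * of_nat j))
   = of_nat (w2 * w3) ^ n * (\<Sum>i=0..<w2. \<Sum>j=0..<w3. (-1) ^ (i + j) *
        euler_poly n (of_nat w1 * y1 + of_nat w1 / of_nat w2 * of_nat i
                                     + of_nat w1 / of_nat w3 * of_nat j))
   \<and> of_nat (w2 * w3) ^ n * (\<Sum>i=0..<w2. \<Sum>j=0..<w3. (-1) ^ (i + j) *
        euler_poly n (of_nat w1 * y1 + of_nat w1 / of_nat w2 * of_nat i
                                     + of_nat w1 / of_nat w3 * of_nat j))
   = of_nat (w3 * w1) ^ n * (\<Sum>i=0..<w3. \<Sum>j=0..<w1. (-1) ^ (i + j) *
        euler_poly n (of_nat w2 * y1 + of_nat w2 / of_nat w3 * of_nat i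
                                     + of_nat w2 / of_nat w1 * of_nat j))"
  \<comment> \<open>Each side becomes \<open>fact n\<close> times an n-th coefficient, so two
    successive rotations give the two equations.\<close>
  unfolding euler_double_sum_gf_nth[symmetric]
  using euler_double_sum_gf_rotate[of w1 w2 w3 y1] euler_double_sum_gf_rotate[of w2 w3 w1 y1] assms
  by simp

end
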